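(* The critical threshold value $\mu(\chi)$ of a complete simple game $\chi\in\mathcal C_n$ is in $O\!\left(\frac{n\cdot\log\log n}{\log n}\right)$; that is, there exist a constant $C>0$ and an integer $n_0$ such that for all $n\ge n_0$ and all $\chi\in\mathcal C_n$, $\mu(\chi)\le C\cdot\frac{n\log\log n}{\log n}$.
   Context: Let $N=\{1,\dots,n\}$. A simple game on $n$ voters is a function $\chi:2^N\to\{0,1\}$ with $\chi(\emptyset)=0$, $\chi(N)=1$ and $\chi(S)\le\chi(T)$ whenever $S\subseteq T\subseteq N$. A coalition $S$ is winning if $\chi(S)=1$ and losing if $\chi(S)=0$. For voters $i,j\in N$ write $i\sqsupset j$ if $\chi(\{i\}\cup S\setminus\{j\})\ge\chi(S)$ for all $S$ with $j\in S\subseteq N\setminus\{i\}$. The simple game is complete if $\sqsupset$ is a total preorder on $N$; $\mathcal C_n$ is the set of complete simple games on $n$ voters. For real weights write $w(S)=\sum_{i\in S}w_i$. For real $\alpha\ge 1$, $\chi$ is $\alpha$-roughly weighted if there are $w_1,\dots,w_n\in\mathbb R$ with $w(S)\ge 1$ for all winning $S$ and $w(S)\le\alpha$ for all losing $S$. The critical threshold value $\mu(\chi)$ is the smallest $\alpha\ge 1$ such that $\chi$ is $\alpha$-roughly weighted. *)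

theory Defs
  imports "HOL-Analysis.Analysis"
begin

text \<open>
  Voters are \<open>1, \<dots>, n\<close>.  Only the values of \<open>\<phi>\<close> on subsets of \<open>{1..n}\<close> matter below.
\<close>

definition simple_game :: "nat \<Rightarrow> (nat set \<Rightarrow> nat) \<Rightarrow> bool" where
  "simple_game n \<phi> \<longleftrightarrow>
     \<phi> \<in> Pow {1..n} \<rightarrow> {0, 1} \<and> \<phi> {} = 0 \<and> \<phi> {1..n} = 1 \<and>
     (\<forall>S T. S \<subseteq> T \<and> T \<subseteq> {1..n} \<longrightarrow> \<phi> S \<le> \<phi> T)"

definition winning :: "nat \<Rightarrow> (nat set \<Rightarrow> nat) \<Rightarrow> nat set \<Rightarrow> bool" where
  "winning n \<phi> S \<longleftrightarrow> S \<subseteq> {1..n} \<and> \<phi> S = 1"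

definition losing :: "nat \<Rightarrow> (nat set \<Rightarrow> nat) \<Rightarrow> nat set \<Rightarrow> bool" where
  "losing n \<phi> S \<longleftrightarrow> S \<subseteq> {1..n} \<and> \<phi> S = 0"

text \<open>
  The relation \<open>\<sqsupset>\<close> on voters, as a set of pairs.  The condition is vacuous for \<open>i = j\<close>.
\<close>

definition desirability :: "nat \<Rightarrow> (nat set \<Rightarrow> nat) \<Rightarrow> nat rel" where
  "desirability n \<phi> =
     {(i, j). i \<in> {1..n} \<and> j \<in> {1..n} \<and>
        (\<forall>S. j \<in> S \<and> S \<subseteq> {1..n} - {i} \<longrightarrow> \<phi> (({i} \<union> S) - {j}) \<ge> \<phi> S)}"

definition complete_simple_games :: "nat \<Rightarrow> (nat set \<Rightarrow> nat) set" where
  "complete_simple_games n =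
     {\<phi>. simple_game n \<phi> \<and> preorder_on {1..n} (desirability n \<phi>) \<and>
         total_on {1..n} (desirability n \<phi>)}"

definition roughly_weighted :: "nat \<Rightarrow> (nat set \<Rightarrow> nat) \<Rightarrow> real \<Rightarrow> bool" where
  "roughly_weighted n \<phi> \<alpha> \<longleftrightarrow>
     (\<exists>w :: nat \<Rightarrow> real.
        (\<forall>S. winning n \<phi> S \<longrightarrow> (\<Sum>i\<in>S. w i) \<ge> 1) \<and>
        (\<forall>S. losing n \<phi> S \<longrightarrow> (\<Sum>i\<in>S. w i) \<le> \<alpha>))"

definition critical_threshold :: "nat \<Rightarrow> (nat set \<Rightarrow> nat) \<Rightarrow> real" where
  "critical_threshold n \<phi> = (LEAST \<alpha>. \<alpha> \<ge> 1 \<and> roughly_weighted n \<phi> \<alpha>)"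

text \<open>
  \<open>LEAST\<close> on the reals is unspecified unless a minimum exists.  For simple games it does:
  weights may be clipped to \<open>[0, 1]\<close>, after which the feasible set is compact.
\<close>

lemma roughly_weighted_clip:
  assumes g: "simple_game n \<phi>"
    and win: "\<forall>S. winning n \<phi> S \<longrightarrow> (\<Sum>i\<in>S. w i) \<ge> (1::real)"
    and los: "\<forall>S. losing n \<phi> S \<longrightarrow> (\<Sum>i\<in>S. w i) \<le> \<alpha>"
  shows "\<forall>S. winning n \<phi> S \<longrightarrow> (\<Sum>i\<in>S. max 0 (min 1 (w i))) \<ge> 1"
    and "\<forall>S. losing n \<phi> S \<longrightarrow> (\<Sum>i\<in>S. max 0 (min 1 (w i))) \<le> \<alpha>"
proof -
  let ?v = "\<lambda>i. max 0 (min 1 (w i))"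
  show "\<forall>S. winning n \<phi> S \<longrightarrow> (\<Sum>i\<in>S. ?v i) \<ge> 1"
  proof (intro allI impI)
    fix S assume S: "winning n \<phi> S"
    then have fin: "finite S" by (auto simp: winning_def intro: finite_subset)
    show "(\<Sum>i\<in>S. ?v i) \<ge> 1"
    proof (cases "\<exists>i\<in>S. w i \<ge> 1")
      case True
      then obtain i where i: "i \<in> S" "w i \<ge> 1" by blast
      have "?v i \<le> (\<Sum>i\<in>S. ?v i)" by (rule member_le_sum[OF i(1)]) (use fin in auto)
      then show ?thesis using i by simp
    next
      case False
      then have "(\<Sum>i\<in>S. w i) \<le> (\<Sum>i\<in>S. ?v i)" by (intro sum_mono) auto
      moreover have "1 \<le> (\<Sum>i\<in>S. w i)" using win S by blast
      ultimately show ?thesis by linarith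
    qed
  qed
  show "\<forall>S. losing n \<phi> S \<longrightarrow> (\<Sum>i\<in>S. ?v i) \<le> \<alpha>"
  proof (intro allI impI)
    fix S assume S: "losing n \<phi> S"
    then have fin: "finite S" by (auto simp: losing_def intro: finite_subset)
    let ?T = "{i\<in>S. w i > 0}"
    have "\<phi> ?T \<le> \<phi> S"
      using g S unfolding simple_game_def losing_def by (metis (lifting) mem_Collect_eq subsetI)
    then have "losing n \<phi> ?T" using S by (auto simp: losing_def)
    have "(\<Sum>i\<in>S. ?v i) = (\<Sum>i\<in>?T. ?v i)"
      by (rule sum.mono_neutral_right) (use fin in auto)
    also have "\<dots> \<le> (\<Sum>i\<in>?T. w i)" by (rule sum_mono) auto
    also have "\<dots> \<le> \<alpha>" using los \<open>losing n \<phi> ?T\<close> by blast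
    finally show "(\<Sum>i\<in>S. ?v i) \<le> \<alpha>" .
  qed
qed

lemma critical_threshold_least:
  assumes g: "simple_game n \<phi>"
  shows "critical_threshold n \<phi> \<ge> 1"
    and "roughly_weighted n \<phi> (critical_threshold n \<phi>)"
    and "\<And>\<alpha>. \<alpha> \<ge> 1 \<Longrightarrow> roughly_weighted n \<phi> \<alpha> \<Longrightarrow> critical_threshold n \<phi> \<le> \<alpha>"
proof -
  define B where "B = {1..real n + 1} \<times> (PiE UNIV (\<lambda>i::nat. {0..1::real}))"
  define C where "C = {p :: real \<times> (nat \<Rightarrow> real).
     (\<forall>S. winning n \<phi> S \<longrightarrow> 1 \<le> (\<Sum>i\<in>S. snd p i)) \<and>
     (\<forall>S. losing n \<phi> S \<longrightarrow> (\<Sum>i\<in>S. snd p i) \<le> fst p)}"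
  have "compactin (product_topology (\<lambda>i::nat. euclidean :: real topology) UNIV)
          (PiE UNIV (\<lambda>i::nat. {0..1::real}))"
    by (subst compactin_PiE) auto
  then have "compact (PiE UNIV (\<lambda>i::nat. {0..1::real}))"
    by (simp add: euclidean_product_topology)
  then have "compact B" unfolding B_def by (intro compact_Times) auto
  have coord: "continuous_on UNIV (\<lambda>p :: real \<times> (nat \<Rightarrow> real). snd p i)" for i
    by (rule continuous_on_product_then_coordinatewise[OF continuous_on_snd[OF continuous_on_id]])
  have "closed C" unfolding C_def
    by (intro closed_Collect_conj closed_Collect_all closed_Collect_imp closed_Collect_le
          continuous_intros coord) auto
  have "compact (B \<inter> C)" using \<open>compact B\<close> \<open>closed C\<close> by (rule compact_Int_closed)
  have ne: "(real n + 1, \<lambda>_. 1) \<in> B \<inter> C"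
  proof -
    have "1 \<le> card S" if "winning n \<phi> S" for S
    proof -
      have "S \<noteq> {}" using that g by (auto simp: winning_def simple_game_def)
      moreover have "finite S" using that by (auto simp: winning_def intro: finite_subset)
      ultimately show ?thesis by (simp add: Suc_le_eq card_gt_0_iff)
    qed
    moreover have "card S \<le> n" if "losing n \<phi> S" for S
      using that card_mono[of "{1..n}" S] by (auto simp: losing_def)
    ultimately show ?thesis
      by (force simp: B_def C_def)
  qed
  then have "B \<inter> C \<noteq> {}" by blast
  obtain p where p: "p \<in> B \<inter> C" and least: "\<forall>q\<in>B \<inter> C. fst p \<le> fst q"
    using continuous_attains_inf[OF \<open>compact (B \<inter> C)\<close> \<open>B \<inter> C \<noteq> {}\<close>, of fst]
      continuous_on_fst[OF continuous_on_id] by blast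
  have p1: "fst p \<ge> 1" using p by (auto simp: B_def)
  have p2: "roughly_weighted n \<phi> (fst p)" using p by (auto simp: C_def roughly_weighted_def)
  have p3: "fst p \<le> \<alpha>" if a: "\<alpha> \<ge> 1" "roughly_weighted n \<phi> \<alpha>" for \<alpha>
  proof (cases "\<alpha> \<le> real n + 1")
    case True
    from a(2) obtain w where w: "\<forall>S. winning n \<phi> S \<longrightarrow> (\<Sum>i\<in>S. w i) \<ge> (1::real)"
      "\<forall>S. losing n \<phi> S \<longrightarrow> (\<Sum>i\<in>S. w i) \<le> \<alpha>" unfolding roughly_weighted_def by blast
    have "(\<alpha>, \<lambda>i. max 0 (min 1 (w i))) \<in> B \<inter> C"
      using roughly_weighted_clip[OF g w] a(1) True by (auto simp: B_def C_def)
    then show ?thesis using least by force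
  next
    case False
    then show ?thesis using least ne by force
  qed
  have eq: "critical_threshold n \<phi> = fst p"
    unfolding critical_threshold_def by (rule Least_equality) (use p1 p2 p3 in auto)
  show "critical_threshold n \<phi> \<ge> 1" "roughly_weighted n \<phi> (critical_threshold n \<phi>)"
    "\<And>\<alpha>. \<alpha> \<ge> 1 \<Longrightarrow> roughly_weighted n \<phi> \<alpha> \<Longrightarrow> critical_threshold n \<phi> \<le> \<alpha>"
    using p1 p2 p3 eq by auto
qed

end

theory Submission
  imports Defs "HOL-Real_Asymp.Real_Asymp"
begin

text \<open>
  Fix \<open>k \<ge> 1\<close>.  Among the winning coalitions with fewer than \<open>k\<close> members choose one, \<open>S\<close>, whose
  strongest member \<open>x\<close> is as weak as possible, and let \<open>A\<close> be the set of voters at least as strong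
  as \<open>x\<close>.  Every winning coalition with fewer than \<open>k\<close> members meets \<open>A\<close>, while a losing coalition
  has fewer than \<open>card S < k\<close> members in \<open>A\<close>, since such members could replace those of \<open>S\<close> one
  at a time.  Hence weight \<open>1/k\<close> for every voter, plus \<open>1\<close> on \<open>A\<close>, shows that the critical
  threshold is at most \<open>n/k + k\<close>; with \<open>k\<close> close to \<open>sqrt n\<close> this is even \<open>O(sqrt n)\<close>.
\<close>

text \<open>Induction on \<open>card (S - T)\<close>: trading some \<open>s\<close> in
  \<open>S - T\<close> for a \<open>t\<close> in \<open>T - S\<close> keeps the coalition winning by
  desirability, preserves its size and brings it closer to \<open>T\<close>. Once \<open>S\<close>
  lies inside \<open>T\<close>, monotonicity finishes.\<close>

lemma winning_exchange:
  assumes g: "simple_game n \<phi>" and "winning n \<phi> S" "T \<subseteq> {1..n}" "card S \<le> card T"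
    and "\<And>s t. s \<in> S - T \<Longrightarrow> t \<in> T \<Longrightarrow> (t, s) \<in> desirability n \<phi>"
  shows "winning n \<phi> T"
  using assms(2-)
proof (induction "card (S - T)" arbitrary: S)
  case 0
  have "finite S" using 0 by (auto simp: winning_def intro: finite_subset)
  then have "S \<subseteq> T" using 0 by simp
  then have "\<phi> S \<le> \<phi> T" using g 0 by (auto simp: simple_game_def)
  moreover have "\<phi> T \<in> {0, 1}" using g 0 by (auto simp: simple_game_def)
  ultimately show ?case using 0 by (auto simp: winning_def)
next
  case (Suc m)
  have fin: "finite S" "finite T" using Suc.prems by (auto simp: winning_def intro: finite_subset)
  obtain s where s: "s \<in> S" "s \<notin> T"
    using Suc.hyps(2) by (metis Diff_iff card.empty equals0I nat.distinct(1))
  \<comment> \<open>Otherwise \<open>T\<close> would be a subset of \<open>S\<close> that is no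
    smaller, hence equal to \<open>S\<close>, contradicting \<open>s\<close>.\<close>
  obtain t where t: "t \<in> T" "t \<notin> S"
    using Suc.prems(3) s fin by (metis card_seteq subsetI)
  define S' where "S' = ({t} \<union> S) - {s}"
  have "(t, s) \<in> desirability n \<phi>" using Suc.prems(4) s t by blast
  then have "\<phi> S' \<ge> \<phi> S"
    using Suc.prems(1) s t by (auto simp: desirability_def S'_def winning_def)
  moreover have S': "S' \<subseteq> {1..n}" using Suc.prems t by (auto simp: S'_def winning_def)
  then have "\<phi> S' \<in> {0, 1}" using g by (auto simp: simple_game_def)
  ultimately have "winning n \<phi> S'" using Suc.prems(1) S' by (auto simp: winning_def)
  moreover have "S' - T = (S - T) - {s}" using t by (auto simp: S'_def)
  then have "m = card (S' - T)" using Suc.hyps(2) s fin by simp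
  moreover have "card S' = card S" using s t fin
    by (simp add: S'_def card_gt_0_iff card_Diff_singleton)
  ultimately show ?case using Suc.hyps(1)[of S'] Suc.prems \<open>S' - T = _\<close> by auto
qed

text \<open>The rank of \<open>x\<close> counts the \<open>y\<close> with
  \<open>(y, x) \<in> r\<close>; by transitivity these sets grow along \<open>r\<close>. Numerical
  ranks make \<open>Min\<close> and \<open>Max\<close> available for choosing strongest and weakest
  voters.\<close>

lemma total_preorder_rank:
  assumes "finite A" "r \<subseteq> A \<times> A" "preorder_on A r" "total_on A r"
  obtains f :: "'a \<Rightarrow> nat" where "\<And>x y. x \<in> A \<Longrightarrow> y \<in> A \<Longrightarrow> (x, y) \<in> r \<longleftrightarrow> f x \<le> f y"
proof
  define U where "U x = {y. (y, x) \<in> r}" for x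
  have fin: "finite (U x)" for x
    by (rule finite_subset[OF _ assms(1)]) (use assms(2) in \<open>auto simp: U_def\<close>)
  have refl: "(x, x) \<in> r" if "x \<in> A" for x
    using assms(3) that by (auto simp: preorder_on_def refl_on_def)
  have sub: "U x \<subseteq> U y" if "(x, y) \<in> r" for x y
    using assms(3) that by (auto simp: preorder_on_def U_def dest: transD)
  fix x y assume xy: "x \<in> A" "y \<in> A"
  show "(x, y) \<in> r \<longleftrightarrow> card (U x) \<le> card (U y)"
  proof
    assume "(x, y) \<in> r"
    then show "card (U x) \<le> card (U y)" by (intro card_mono fin sub)
  next
    assume le: "card (U x) \<le> card (U y)"
    show "(x, y) \<in> r"
    proof (rule ccontr)
      assume n: "(x, y) \<notin> r"
      then have yx: "(y, x) \<in> r" using assms(4) xy refl unfolding total_on_def by metis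
      \<comment> \<open>Equality puts \<open>x\<close>, a member of \<open>U x\<close> by
        reflexivity, into \<open>U y\<close>, which is \<open>(x, y) \<in> r\<close>.\<close>
      have "U y = U x" by (rule card_seteq[OF fin sub[OF yx] le])
      then show False using n refl[OF xy(1)] by (auto simp: U_def)
    qed
  qed
qed

lemma critical_threshold_le:
  assumes \<phi>: "\<phi> \<in> complete_simple_games n" and k: "0 < k"
  shows "critical_threshold n \<phi> \<le> real n / real k + real k"
proof -
  have g: "simple_game n \<phi>" using \<phi> by (auto simp: complete_simple_games_def)
  have "desirability n \<phi> \<subseteq> {1..n} \<times> {1..n}" by (auto simp: desirability_def)
  then obtain f :: "nat \<Rightarrow> nat"
    where f: "\<And>i j. i \<in> {1..n} \<Longrightarrow> j \<in> {1..n} \<Longrightarrow> (i, j) \<in> desirability n \<phi> \<longleftrightarrow> f i \<le> f j"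
    using total_preorder_rank[of "{1..n}" "desirability n \<phi>"] \<phi>
    by (auto simp: complete_simple_games_def)
  define small where "small = {S. winning n \<phi> S \<and> card S < k}"
  have fin: "finite S" if "S \<subseteq> {1..n}" for S :: "nat set" using that by (rule finite_subset) simp
  have "\<exists>A\<subseteq>{1..n}. (\<forall>S\<in>small. S \<inter> A \<noteq> {}) \<and> (\<forall>T. losing n \<phi> T \<longrightarrow> card (T \<inter> A) \<le> k)"
  proof (cases "small = {}")
    case True
    \<comment> \<open>With no small winning coalition there is nothing to meet, and weight
      \<open>1 / k\<close> per voter is enough.\<close>
    then show ?thesis by (intro exI[of _ "{}"]) auto
  next
    case False
    have "finite small"
      by (rule finite_subset[of _ "Pow {1..n}"]) (auto simp: small_def winning_def)
    \<comment> \<open>Stronger voters have smaller \<open>f\<close>, so \<open>top S\<close> is the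
      rank of the strongest member of \<open>S\<close>, and maximising it makes that member as weak
      as possible.\<close>
    define top where "top S = Min (f ` S)" for S
    obtain S where S: "S \<in> small" and weakest: "\<And>S'. S' \<in> small \<Longrightarrow> top S' \<le> top S"
      using Max_in[of "top ` small"] Max_ge[of "top ` small"] \<open>finite small\<close> False
      by (metis (no_types, lifting) finite_imageI image_iff image_is_empty)
    define A where "A = {i \<in> {1..n}. f i \<le> top S}"
    have "S' \<inter> A \<noteq> {}" if S': "S' \<in> small" for S'
    proof -
      have "S' \<noteq> {}" "S' \<subseteq> {1..n}"
        using S' g by (auto simp: small_def winning_def simple_game_def)
      then have "top S' \<in> f ` S'" unfolding top_def by (intro Min_in) (simp_all add: fin)
      then obtain i where "i \<in> S'" "f i = top S'" by (metis imageE)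
      moreover from this have "i \<in> A"
        using weakest[OF S'] \<open>S' \<subseteq> {1..n}\<close> by (force simp: A_def)
      ultimately show ?thesis by blast
    qed
    moreover have "card (T \<inter> A) \<le> k" if T: "losing n \<phi> T" for T
    proof (rule ccontr)
      assume "\<not> card (T \<inter> A) \<le> k"
      then have "card S \<le> card (T \<inter> A)" using S by (auto simp: small_def)
      have sub: "S \<subseteq> {1..n}" using S by (auto simp: small_def winning_def)
      \<comment> \<open>The rank \<open>top S\<close> separates the two sides:
        \<open>f t \<le> top S \<le> f s\<close>.\<close>
      have stronger: "(t, s) \<in> desirability n \<phi>" if "s \<in> S" "t \<in> A" for s t
      proof -
        have "top S \<le> f s" using that fin[OF sub] by (auto simp: top_def)
        then show ?thesis using that sub by (subst f) (auto simp: A_def)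
      qed
      have "winning n \<phi> (T \<inter> A)"
        by (rule winning_exchange[OF g _ _ \<open>card S \<le> card (T \<inter> A)\<close>])
          (use S T stronger in \<open>auto simp: small_def losing_def\<close>)
      moreover have "\<phi> (T \<inter> A) \<le> \<phi> T"
        using g T Int_lower1[of T A] unfolding simple_game_def losing_def by blast
      ultimately show False using T by (auto simp: losing_def winning_def)
    qed
    ultimately show ?thesis by (intro exI[of _ A]) (auto simp: A_def)
  qed
  then obtain A where A: "A \<subseteq> {1..n}" "\<And>S. S \<in> small \<Longrightarrow> S \<inter> A \<noteq> {}"
    "\<And>T. losing n \<phi> T \<Longrightarrow> card (T \<inter> A) \<le> k" by blast
  define w where "w i = 1 / real k + of_bool (i \<in> A)" for i
  have w: "sum w S = real (card S) / real k + real (card (S \<inter> A))" if "S \<subseteq> {1..n}" for S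
    using fin[OF that] by (simp add: w_def sum.distrib of_bool_def sum.If_cases)
  have "1 \<le> sum w S" if S: "winning n \<phi> S" for S
  proof (cases "card S < k")
    case True
    then have "card (S \<inter> A) > 0"
      using A S fin by (auto simp: small_def winning_def card_gt_0_iff)
    moreover have "0 \<le> real (card S) / real k" by simp
    ultimately show ?thesis using S unfolding winning_def by (subst w) linarith+
  next
    case False
    then have "1 \<le> real (card S) / real k" using k by simp
    then show ?thesis using S by (subst w) (auto simp: winning_def)
  qed
  moreover have "sum w T \<le> real n / real k + real k" if T: "losing n \<phi> T" for T
  proof -
    have "card T \<le> n" using T card_mono[of "{1..n}" T] by (auto simp: losing_def)
    then show ?thesis using T A(3)[OF T]
      by (subst w) (auto simp: losing_def intro!: add_mono divide_right_mono)
  qed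
  ultimately have "roughly_weighted n \<phi> (real n / real k + real k)"
    unfolding roughly_weighted_def by blast
  moreover have "1 \<le> real n / real k + real k"
  proof -
    have "0 \<le> real n / real k" by simp
    then show ?thesis using k by linarith
  qed
  ultimately show ?thesis using critical_threshold_least(3)[OF g] by blast
qed

lemma critical_threshold_le_sqrt:
  assumes "\<phi> \<in> complete_simple_games n"
  shows "critical_threshold n \<phi> \<le> 2 * sqrt (real n) + 1"
proof -
  have "n > 0"
    \<comment> \<open>For \<open>n = 0\<close> the empty and the full coalition coincide, yet must
      have values 0 and 1.\<close>
    using assms by (auto simp: complete_simple_games_def simple_game_def intro: gr0I)
  \<comment> \<open>This choice balances \<open>n / k\<close> against \<open>k\<close>; rounding up
    costs at most 1 and only decreases \<open>n / k\<close>.\<close>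
  define k where "k = nat \<lceil>sqrt (real n)\<rceil>"
  have k: "0 < k" "sqrt (real n) \<le> real k" "real k \<le> sqrt (real n) + 1"
    using \<open>n > 0\<close> unfolding k_def by (simp_all add: of_nat_ceiling)
  have "real n / real k \<le> real n / sqrt (real n)"
    using k \<open>n > 0\<close> by (intro divide_left_mono) simp_all
  also have "\<dots> = sqrt (real n)" by (simp add: real_div_sqrt)
  finally show ?thesis using critical_threshold_le[OF assms k(1)] k by linarith
qed

theorem theorem2:
  shows "\<exists>C::real. C > 0 \<and> (\<exists>n0::nat. \<forall>n\<ge>n0. \<forall>\<phi>\<in>complete_simple_games n.
           critical_threshold n \<phi> \<le> C * (real n * ln (ln (real n)) / ln (real n)))"
proof -
  \<comment> \<open>The constant 1 suffices, since \<open>sqrt n\<close> is of smaller order than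
    \<open>n * ln (ln n) / ln n\<close>.\<close>
  have "\<forall>\<^sub>F n in sequentially.
          2 * sqrt (real n) + 1 \<le> 1 * (real n * ln (ln (real n)) / ln (real n))"
    by real_asymp
  then obtain n0 where "\<forall>n\<ge>n0.
      2 * sqrt (real n) + 1 \<le> 1 * (real n * ln (ln (real n)) / ln (real n))"
    unfolding eventually_sequentially by blast
  then have "\<forall>n\<ge>n0. \<forall>\<phi>\<in>complete_simple_games n.
      critical_threshold n \<phi> \<le> 1 * (real n * ln (ln (real n)) / ln (real n))"
    using critical_threshold_le_sqrt order_trans by blast
  then show ?thesis using zero_less_one by blast
qed

end
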